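(* Let $\alpha>0$ and let $k$ be a positive integer. For any initialization $\{\phi_i\}_{i=1}^k\in\mathcal A_k$, the rearrangement algorithm terminates in a finite number of steps at a local minimum of $\Lambda_k^\alpha$ over $\mathcal A_k$.
   Context: $G=(V,E)$ is a finite undirected graph with non-negative edge weights $w_{ij}=w_{ji}\ge 0$ (with $w_{ij}=0$ if $(i,j)\notin E$). Degrees are $d_i=\sum_j w_{ij}$, and $r\in[0,1]$ is a fixed parameter. For $\psi:V\to\mathbb R$ put $$\|\nabla\psi\|_{w,E}^2=\sum_{(i,j)\in E}w_{ij}(\psi_i-\psi_j)^2,\qquad \|\psi\|^2=\|\psi\|_V^2=\sum_{i\in V}d_i^r\psi_i^2,$$ and, for $f:V\to[0,\infty)$, $\|\psi\|_f^2=\sum_{i\in V}d_i^r f_i\psi_i^2$. For $\alpha>0$ and $\phi:V\to[0,1]$ define $$\lambda^\alpha(\phi)=\inf_{\|\psi\|=1}\ \|\nabla\psi\|_{w,E}^2+\alpha\|\psi\|^2_{(1-\phi)}.$$ This is the first eigenvalue of the operator $\Delta_r+\alpha(1-\phi)$, where $\Delta_r=D^{-r}(D-W)$, $D=\mathrm{diag}(d)$, $W=(w_{ij})$. The minimizer is unique up to scaling and can be chosen strictly positive; throughout, the eigenfunction corresponding to $\lambda^\alpha(\phi)$ is taken to be positive with $\|\psi\|_V=1$. The admissible class is $$\mathcal A_k=\Big\{\{\phi_i\}_{i=1}^k:\ \phi_i:V\to[0,1],\ \sum_{i=1}^k\phi_i=1\Big\},$$ and the relaxed energy is $\Lambda_k^\alpha(\{\phi_i\}_{i=1}^k)=\sum_{i=1}^k\lambda^\alpha(\phi_i)$,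 which is to be minimized over $\mathcal A_k$. Rearrangement algorithm: starting from an initial $\{\phi_i\}_{i=1}^k\in\mathcal A_k$, repeat the following while not converged (that is, until a fixed point is reached): (1) for $i=1,\dots,k$ compute the positive normalized eigenfunction $\psi_i$ corresponding to $\lambda^\alpha(\phi_i)$; (2) assign each node $v\in V$ the label $i=\arg\max_j\psi_j(v)$; (3) let the new $\{\phi_i\}_{i=1}^k$ be the indicator functions for the labels.
   Formalization: Arg max ties need a rule: the claim fails for some rules (all φ_i=1/k, smallest label). Proved: any rule terminates, at a local minimum if arg max is unique at the final point; and some tie-breaking rule always ends at a local minimum. The graph is assumed connected. *)

theory Defs
  imports "HOL-Analysis.Analysis"
begin

text \<open>The vertex set is the finite type \<open>'v\<close>, and the \<open>k\<close> labels form a finite type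
  \<open>'k\<close>, so \<open>k = CARD('k)\<close> is an arbitrary positive integer. A family
  \<open>\<phi>\<^sub>1, \<dots>, \<phi>\<^sub>k\<close> of vertex functions is \<open>\<phi> :: real ^ 'v ^ 'k\<close>, with \<open>\<phi> $ i $ v\<close> for
  the value of the \<open>i\<close>-th function at \<open>v\<close>.\<close>

text \<open>An undirected edge is represented by both of its orientations.\<close>

definition weighted_graph :: "('v::finite \<times> 'v) set \<Rightarrow> ('v \<Rightarrow> 'v \<Rightarrow> real) \<Rightarrow> bool" where
  "weighted_graph E w \<longleftrightarrow>
     sym E \<and> (\<forall>i j. w i j = w j i) \<and> (\<forall>i j. 0 \<le> w i j) \<and> (\<forall>i j. (i, j) \<notin> E \<longrightarrow> w i j = 0)"

text \<open>Edges of weight zero do not connect. This is the condition under which the first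
  eigenvalue is simple with a positive eigenfunction for every potential.\<close>

definition connected_weights :: "('v::finite \<Rightarrow> 'v \<Rightarrow> real) \<Rightarrow> bool" where
  "connected_weights w \<longleftrightarrow> (\<forall>i j. (i, j) \<in> {(a, b). 0 < w a b}\<^sup>*)"

definition deg :: "('v::finite \<Rightarrow> 'v \<Rightarrow> real) \<Rightarrow> 'v \<Rightarrow> real" where
  "deg w i = (\<Sum>j\<in>UNIV. w i j)"

text \<open>\<open>d\<^sub>i\<^sup>r\<close> with \<open>0\<^sup>0 = 1\<close>, whereas \<open>0 powr 0 = 0\<close>; this matters only for an isolated vertex.\<close>

definition deg_pow :: "('v::finite \<Rightarrow> 'v \<Rightarrow> real) \<Rightarrow> real \<Rightarrow> 'v \<Rightarrow> real" where
  "deg_pow w r i = (if r = 0 then 1 else deg w i powr r)"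

text \<open>The factor \<open>1/2\<close> makes every undirected edge count once, so that this is the quadratic
  form of \<open>D - W\<close>.\<close>

definition grad_sq :: "('v::finite \<times> 'v) set \<Rightarrow> ('v \<Rightarrow> 'v \<Rightarrow> real) \<Rightarrow> real ^ 'v \<Rightarrow> real" where
  "grad_sq E w \<psi> = (\<Sum>(i, j)\<in>E. w i j * (\<psi> $ i - \<psi> $ j)\<^sup>2) / 2"

definition norm_sq :: "('v::finite \<Rightarrow> 'v \<Rightarrow> real) \<Rightarrow> real \<Rightarrow> real ^ 'v \<Rightarrow> real" where
  "norm_sq w r \<psi> = (\<Sum>i\<in>UNIV. deg_pow w r i * (\<psi> $ i)\<^sup>2)"

definition weighted_norm_sq ::
    "('v::finite \<Rightarrow> 'v \<Rightarrow> real) \<Rightarrow> real \<Rightarrow> real ^ 'v \<Rightarrow> real ^ 'v \<Rightarrow> real" where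
  "weighted_norm_sq w r f \<psi> = (\<Sum>i\<in>UNIV. deg_pow w r i * f $ i * (\<psi> $ i)\<^sup>2)"

definition lam ::
    "('v::finite \<times> 'v) set \<Rightarrow> ('v \<Rightarrow> 'v \<Rightarrow> real) \<Rightarrow> real \<Rightarrow> real \<Rightarrow> real ^ 'v \<Rightarrow> real" where
  "lam E w r \<alpha> \<phi> =
     (INF \<psi>\<in>{\<psi>. norm_sq w r \<psi> = 1}.
        grad_sq E w \<psi> + \<alpha> * weighted_norm_sq w r (\<chi> v. 1 - \<phi> $ v) \<psi>)"

text \<open>\<open>\<Delta>\<^sub>r = D\<^sup>-\<^sup>r (D - W)\<close>\<close>

definition laplacian :: "('v::finite \<Rightarrow> 'v \<Rightarrow> real) \<Rightarrow> real \<Rightarrow> real ^ 'v \<Rightarrow> real ^ 'v" where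
  "laplacian w r \<psi> = (\<chi> i. (deg w i * \<psi> $ i - (\<Sum>j\<in>UNIV. w i j * \<psi> $ j)) / deg_pow w r i)"

definition is_ground_state :: "('v::finite \<times> 'v) set \<Rightarrow> ('v \<Rightarrow> 'v \<Rightarrow> real) \<Rightarrow> real \<Rightarrow> real \<Rightarrow>
    real ^ 'v \<Rightarrow> real ^ 'v \<Rightarrow> bool" where
  "is_ground_state E w r \<alpha> \<phi> \<psi> \<longleftrightarrow>
     (\<forall>v. laplacian w r \<psi> $ v + \<alpha> * (1 - \<phi> $ v) * \<psi> $ v = lam E w r \<alpha> \<phi> * \<psi> $ v) \<and>
     (\<forall>v. 0 < \<psi> $ v) \<and> norm_sq w r \<psi> = 1"

definition ground_state :: "('v::finite \<times> 'v) set \<Rightarrow> ('v \<Rightarrow> 'v \<Rightarrow> real) \<Rightarrow> real \<Rightarrow> real \<Rightarrow>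
    real ^ 'v \<Rightarrow> real ^ 'v" where
  "ground_state E w r \<alpha> \<phi> = (THE \<psi>. is_ground_state E w r \<alpha> \<phi> \<psi>)"

definition admissible :: "(real ^ 'v::finite ^ 'k::finite) set" where
  "admissible = {\<phi>. (\<forall>i v. 0 \<le> \<phi> $ i $ v \<and> \<phi> $ i $ v \<le> 1) \<and> (\<forall>v. (\<Sum>i\<in>UNIV. \<phi> $ i $ v) = 1)}"

definition energy :: "('v::finite \<times> 'v) set \<Rightarrow> ('v \<Rightarrow> 'v \<Rightarrow> real) \<Rightarrow> real \<Rightarrow> real \<Rightarrow>
    real ^ 'v ^ 'k::finite \<Rightarrow> real" where
  "energy E w r \<alpha> \<phi> = (\<Sum>i\<in>UNIV. lam E w r \<alpha> (\<phi> $ i))"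

definition is_local_min_on :: "'a::topological_space set \<Rightarrow> ('a \<Rightarrow> real) \<Rightarrow> 'a \<Rightarrow> bool" where
  "is_local_min_on S f x \<longleftrightarrow> x \<in> S \<and> (\<forall>\<^sub>F y in at x within S. f x \<le> f y)"

definition ground_states :: "('v::finite \<times> 'v) set \<Rightarrow> ('v \<Rightarrow> 'v \<Rightarrow> real) \<Rightarrow> real \<Rightarrow> real \<Rightarrow>
    real ^ 'v ^ 'k::finite \<Rightarrow> real ^ 'v ^ 'k" where
  "ground_states E w r \<alpha> \<phi> = (\<chi> i. ground_state E w r \<alpha> (\<phi> $ i))"

text \<open>A choice of \<open>arg max\<^sub>j \<psi>\<^sub>j(v)\<close> as a function of \<open>\<psi>\<^sub>1, \<dots>, \<psi>\<^sub>k\<close> and \<open>v\<close>. The maximal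
  value can be attained by several labels, and then the rule decides which one is taken.\<close>

definition arg_max_rule :: "(real ^ 'v::finite ^ 'k::finite \<Rightarrow> 'v \<Rightarrow> 'k) \<Rightarrow> bool" where
  "arg_max_rule \<sigma> \<longleftrightarrow> (\<forall>\<psi> v. is_arg_max (\<lambda>j. \<psi> $ j $ v) (\<lambda>j. True) (\<sigma> \<psi> v))"

definition tie_free :: "real ^ 'v::finite ^ 'k::finite \<Rightarrow> bool" where
  "tie_free \<psi> \<longleftrightarrow> (\<forall>v. \<exists>!i. is_arg_max (\<lambda>j. \<psi> $ j $ v) (\<lambda>j. True) i)"

definition rearrange :: "('v::finite \<times> 'v) set \<Rightarrow> ('v \<Rightarrow> 'v \<Rightarrow> real) \<Rightarrow> real \<Rightarrow> real \<Rightarrow>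
    (real ^ 'v ^ 'k::finite \<Rightarrow> 'v \<Rightarrow> 'k) \<Rightarrow> real ^ 'v ^ 'k \<Rightarrow> real ^ 'v ^ 'k" where
  "rearrange E w r \<alpha> \<sigma> \<phi> =
     (\<chi> i v. if \<sigma> (ground_states E w r \<alpha> \<phi>) v = i then 1 else 0)"

definition terminates_at :: "('a \<Rightarrow> 'a) \<Rightarrow> 'a \<Rightarrow> 'a \<Rightarrow> bool" where
  "terminates_at step x y \<longleftrightarrow> (\<exists>n. y = (step ^^ n) x) \<and> step y = y"

end

(* Replacing a family of potentials by the indicators of any arg max labelling of its ground states
   does not increase the energy, since every ground state stays a competitor in its own eigenvalue
   problem. If the energy stays the same, all ground states are still minimizers, hence unchanged,
   and the algorithm has stopped; as there are finitely many labellings, this must happen.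
   Ground states depend continuously on the potential, so near a tie-free fixed point every
   admissible family is rearranged into that fixed point in one step, which makes it a local minimum.
   Breaking ties by least energy forces fixed points to be tie-free as soon as there are two
   vertices; on a single vertex the energy is constant. *)

theory Submission
  imports Defs
begin

section \<open>Termination of energy-decreasing iterations\<close>

text \<open>The values of \<open>f\<close> cannot decrease strictly forever, since after the first
  step the iterates stay in the finite range of \<open>step\<close>. At the first equality it is the
  next iterate that is fixed: the current one may be an arbitrary starting point outside that
  range.\<close>

lemma terminates_at_decreasing:
  fixes step :: "'a \<Rightarrow> 'a" and f :: "'a \<Rightarrow> real"
  assumes fin: "finite (range step)"
    and inv: "\<And>x. x \<in> S \<Longrightarrow> step x \<in> S"
    and le: "\<And>x. x \<in> S \<Longrightarrow> f (step x) \<le> f x"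
    and eq: "\<And>x. x \<in> S \<Longrightarrow> f (step x) = f x \<Longrightarrow> step (step x) = step x"
    and x: "x \<in> S"
  shows "\<exists>y\<in>S. terminates_at step x y"
proof -
  define X where "X n = (step ^^ n) x" for n
  have X_Suc: "X (Suc n) = step (X n)" for n
    by (simp add: X_def)
  have XS: "X n \<in> S" for n
    by (induction n) (use x inv in \<open>auto simp: X_Suc, auto simp: X_def\<close>)
  have "\<exists>n. f (X (Suc n)) = f (X n)"
  proof (rule ccontr)
    assume "\<not> ?thesis"
    then have "f (X (Suc n)) < f (X n)" for n
      using le[OF XS[of n]] by (simp add: X_Suc order.strict_iff_order)
    then have "strict_mono (\<lambda>n. - f (X n))"
      by (simp add: strict_mono_Suc_iff)
    then have "inj (\<lambda>n. f (X n))"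
      using strict_mono_eq unfolding inj_def by (metis (no_types, lifting))
    \<comment> \<open>The start is inserted because it need not be a value of
      \<open>step\<close>.\<close>
    moreover have "range (\<lambda>n. f (X n)) \<subseteq> f ` insert x (range step)"
    proof
      fix y assume "y \<in> range (\<lambda>n. f (X n))"
      then obtain n where "y = f (X n)" by auto
      then show "y \<in> f ` insert x (range step)"
        by (cases n) (auto simp: X_Suc, auto simp: X_def)
    qed
    ultimately show False
      using fin by (meson finite_imageI finite_insert finite_subset finite_imageD infinite_UNIV_nat)
  qed
  then obtain n where "f (X (Suc n)) = f (X n)" ..
  then have "step (X (Suc n)) = X (Suc n)"
    using eq[OF XS[of n]] by (simp add: X_Suc)
  then show ?thesis
    using XS[of "Suc n"] unfolding terminates_at_def X_def by blast
qed

section \<open>Null vectors of symmetric matrices and graph Hamiltonians\<close>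

text \<open>If \<open>A *v m\<close> were nonzero, a small move from \<open>m\<close> against it
  would make the quadratic form negative. This replaces a Lagrange multiplier argument for
  minimizers.\<close>

lemma psd_matrix_null_vector:
  fixes A :: "real ^ 'n ^ 'n"
  assumes sym: "transpose A = A"
    and psd: "\<And>x. 0 \<le> x \<bullet> (A *v x)"
    and m: "m \<bullet> (A *v m) = 0"
  shows "A *v m = 0"
proof (rule ccontr)
  define h where "h = A *v m"
  define s where "s = h \<bullet> h"
  define b where "b = h \<bullet> (A *v h)"
  assume "A *v m \<noteq> 0"
  then have s: "0 < s"
    by (simp add: s_def h_def)
  have b: "0 \<le> b"
    using psd by (simp add: b_def)
  have mh: "m \<bullet> (A *v h) = s"
    by (metis dot_lmul_matrix h_def s_def sym transpose_matrix_vector inner_commute)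
  \<comment> \<open>Along \<open>h\<close> the form is \<open>2 * t * s + t\<^sup>2 * b\<close>.
    This \<open>t\<close> balances the linear against the quadratic term; the summand 1 keeps the
    denominator positive when \<open>b\<close> is 0.\<close>
  define t where "t = - s / (1 + b)"
  have s_eq: "s = - (t * (1 + b))" and t: "t \<noteq> 0"
    using b s by (auto simp: t_def)
  have "(m + t *\<^sub>R h) \<bullet> (A *v (m + t *\<^sub>R h)) = 2 * t * s + t\<^sup>2 * b"
    using m mh by (simp add: matrix_vector_right_distrib matrix_vector_mult_scaleR
        inner_add_left inner_add_right h_def[symmetric] s_def[symmetric] b_def[symmetric]
        power2_eq_square algebra_simps)
  moreover have "\<dots> = - (t\<^sup>2 * (2 + b))"
    unfolding s_eq by (simp add: power2_eq_square algebra_simps)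
  moreover have "0 < t\<^sup>2 * (2 + b)"
    using t b by simp
  ultimately show False
    using psd[of "m + t *\<^sub>R h"] by linarith
qed

text \<open>The matrix D - W + diag(c). Leaving out the factor D^(-r) keeps it symmetric; the
  weights d^r are absorbed into \<open>c\<close> later.\<close>

definition hamiltonian :: "('v::finite \<Rightarrow> 'v \<Rightarrow> real) \<Rightarrow> real ^ 'v \<Rightarrow> real ^ 'v ^ 'v" where
  "hamiltonian w c = (\<chi> i j. (if i = j then deg w i + c $ i else 0) - w i j)"

lemma hamiltonian_mult:
  "(hamiltonian w c *v \<psi>) $ i = (deg w i + c $ i) * \<psi> $ i - (\<Sum>j\<in>UNIV. w i j * \<psi> $ j)"
  by (simp add: hamiltonian_def matrix_vector_mult_def left_diff_distrib sum_subtractf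
      if_distrib[of "\<lambda>x. x * _"] cong: if_cong)

lemma transpose_hamiltonian:
  assumes "weighted_graph E w"
  shows "transpose (hamiltonian w c) = hamiltonian w c"
  using assms by (auto simp: hamiltonian_def transpose_def weighted_graph_def vec_eq_iff)

lemma grad_sq_eq_sum:
  assumes "weighted_graph E w"
  shows "grad_sq E w \<psi> = (\<Sum>i\<in>UNIV. \<Sum>j\<in>UNIV. w i j * (\<psi> $ i - \<psi> $ j)\<^sup>2) / 2"
proof -
  have "(\<Sum>(i, j)\<in>E. w i j * (\<psi> $ i - \<psi> $ j)\<^sup>2) = (\<Sum>(i, j)\<in>UNIV. w i j * (\<psi> $ i - \<psi> $ j)\<^sup>2)"
    using assms by (intro sum.mono_neutral_left) (auto simp: weighted_graph_def)
  then show ?thesis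
    by (simp add: grad_sq_def sum.cartesian_product)
qed

lemma inner_hamiltonian:
  assumes "weighted_graph E w"
  shows "\<psi> \<bullet> (hamiltonian w c *v \<psi>) = grad_sq E w \<psi> + (\<Sum>i\<in>UNIV. c $ i * (\<psi> $ i)\<^sup>2)"
proof -
  have sym: "w i j = w j i" for i j
    using assms by (simp add: weighted_graph_def)
  have swap: "(\<Sum>i\<in>UNIV. \<Sum>j\<in>UNIV. w i j * (\<psi> $ j)\<^sup>2) = (\<Sum>i\<in>UNIV. \<Sum>j\<in>UNIV. w i j * (\<psi> $ i)\<^sup>2)"
    by (subst sum.swap) (simp add: sym)
  have deg: "(\<Sum>i\<in>UNIV. deg w i * (\<psi> $ i)\<^sup>2) = (\<Sum>i\<in>UNIV. \<Sum>j\<in>UNIV. w i j * (\<psi> $ i)\<^sup>2)"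
    by (simp add: deg_def sum_distrib_right)
  have "2 * grad_sq E w \<psi> = (\<Sum>i\<in>UNIV. \<Sum>j\<in>UNIV. w i j * (\<psi> $ i)\<^sup>2 + w i j * (\<psi> $ j)\<^sup>2
      - 2 * (\<psi> $ i * (w i j * \<psi> $ j)))"
    unfolding grad_sq_eq_sum[OF assms] by (simp add: power2_diff algebra_simps)
  also have "\<dots> = 2 * (\<Sum>i\<in>UNIV. deg w i * (\<psi> $ i)\<^sup>2)
      - 2 * (\<Sum>i\<in>UNIV. \<Sum>j\<in>UNIV. \<psi> $ i * (w i j * \<psi> $ j))"
    by (simp add: sum.distrib sum_subtractf swap deg sum_distrib_left)
  finally have "grad_sq E w \<psi> = (\<Sum>i\<in>UNIV. deg w i * (\<psi> $ i)\<^sup>2)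
      - (\<Sum>i\<in>UNIV. \<Sum>j\<in>UNIV. \<psi> $ i * (w i j * \<psi> $ j))"
    by simp
  then show ?thesis
    by (simp add: inner_vec_def hamiltonian_mult right_diff_distrib sum_subtractf sum.distrib
        sum_distrib_left power2_eq_square algebra_simps)
qed

text \<open>A strong maximum principle: at a zero of \<open>\<psi>\<close> the equation reduces to a
  vanishing sum of nonnegative terms over the neighbours, so zeros spread along edges of positive
  weight.\<close>

lemma nonneg_null_vector_hamiltonian:
  assumes "weighted_graph E w" and conn: "connected_weights w"
    and null: "hamiltonian w c *v \<psi> = 0" and nonneg: "\<And>v. 0 \<le> \<psi> $ v"
    and v: "\<psi> $ v = 0"
  shows "\<psi> = 0"
proof -
  have w: "0 \<le> w i j" for i j
    using assms by (simp add: weighted_graph_def)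
  have step: "\<psi> $ b = 0" if "\<psi> $ a = 0" "0 < w a b" for a b
  proof -
    have "(\<Sum>j\<in>UNIV. w a j * \<psi> $ j) = 0"
      using arg_cong[OF null, of "\<lambda>x. x $ a"] that by (simp add: hamiltonian_mult)
    then have "w a b * \<psi> $ b = 0"
      using w nonneg by (subst (asm) sum_nonneg_eq_0_iff) auto
    then show ?thesis using that by simp
  qed
  have "\<psi> $ u = 0" for u
  proof -
    have "(v, u) \<in> {(a, b). 0 < w a b}\<^sup>*"
      using conn by (simp add: connected_weights_def)
    then show ?thesis
      by (induction rule: rtrancl_induct) (use v step in auto)
  qed
  then show ?thesis by (simp add: vec_eq_iff)
qed

text \<open>Subtract from \<open>x\<close> the largest multiple of \<open>y\<close> that leaves the
  difference nonnegative. The difference is a null vector with a zero, so it vanishes.\<close>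

lemma null_vector_hamiltonian_unique:
  assumes G: "weighted_graph E w" "connected_weights w"
    and null: "hamiltonian w c *v x = 0" "hamiltonian w c *v y = 0"
    and pos: "\<And>v. 0 < x $ v" "\<And>v. 0 < y $ v"
  obtains t where "0 < t" "x = t *\<^sub>R y"
proof -
  define t where "t = Min (range (\<lambda>v. x $ v / y $ v))"
  have t_le: "t \<le> x $ v / y $ v" for v
    by (simp add: t_def)
  have "t \<in> range (\<lambda>v. x $ v / y $ v)"
    unfolding t_def by (rule Min_in) auto
  then obtain v where v: "t = x $ v / y $ v" by auto
  have "x - t *\<^sub>R y = 0"
  proof (rule nonneg_null_vector_hamiltonian[OF G])
    show "hamiltonian w c *v (x - t *\<^sub>R y) = 0"
      by (simp add: matrix_vector_mult_diff_distrib matrix_vector_mult_scaleR null)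
    show "0 \<le> (x - t *\<^sub>R y) $ u" for u
      using t_le[of u] pos(2)[of u] by (simp add: field_simps)
    show "(x - t *\<^sub>R y) $ v = 0"
      using v pos(2)[of v] by simp
  qed
  moreover have "0 < t" using v pos by simp
  ultimately show ?thesis using that by simp
qed

section \<open>The quadratic functional\<close>

definition quad ::
    "('v::finite \<times> 'v) set \<Rightarrow> ('v \<Rightarrow> 'v \<Rightarrow> real) \<Rightarrow> real \<Rightarrow> real \<Rightarrow> real ^ 'v \<Rightarrow> real ^ 'v \<Rightarrow> real" where
  "quad E w r \<alpha> \<phi> \<psi> = grad_sq E w \<psi> + \<alpha> * weighted_norm_sq w r (\<chi> v. 1 - \<phi> $ v) \<psi>"

lemma lam_eq_Inf: "lam E w r \<alpha> \<phi> = (INF \<psi>\<in>{\<psi>. norm_sq w r \<psi> = 1}. quad E w r \<alpha> \<phi> \<psi>)"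
  by (simp add: lam_def quad_def)

lemma quad_scaleR: "quad E w r \<alpha> \<phi> (c *\<^sub>R \<psi>) = c\<^sup>2 * quad E w r \<alpha> \<phi> \<psi>"
proof -
  have "grad_sq E w (c *\<^sub>R \<psi>) = c\<^sup>2 * grad_sq E w \<psi>"
    by (simp add: grad_sq_def sum_distrib_left case_prod_unfold power_mult_distrib
        right_diff_distrib[symmetric] mult.left_commute)
  moreover have "weighted_norm_sq w r f (c *\<^sub>R \<psi>) = c\<^sup>2 * weighted_norm_sq w r f \<psi>" for f
    by (simp add: weighted_norm_sq_def sum_distrib_left power_mult_distrib mult.left_commute)
  ultimately show ?thesis
    by (simp add: quad_def algebra_simps)
qed

lemma norm_sq_scaleR: "norm_sq w r (c *\<^sub>R \<psi>) = c\<^sup>2 * norm_sq w r \<psi>"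
  by (simp add: norm_sq_def sum_distrib_left power_mult_distrib mult.left_commute)

lemma continuous_on_quad:
  assumes "continuous_on S f" "continuous_on S g"
  shows "continuous_on S (\<lambda>x. quad E w r \<alpha> (f x) (g x))"
  unfolding quad_def grad_sq_def weighted_norm_sq_def case_prod_unfold
  by (intro continuous_intros assms | simp add: assms)+

lemma continuous_on_norm_sq:
  assumes "continuous_on S g"
  shows "continuous_on S (\<lambda>x. norm_sq w r (g x))"
  unfolding norm_sq_def by (intro continuous_intros assms)

section \<open>Labellings and their indicator families\<close>

definition indicator_family :: "('v::finite \<Rightarrow> 'k::finite) \<Rightarrow> real ^ 'v ^ 'k" where
  "indicator_family s = (\<chi> i v. if s v = i then 1 else 0)"

lemma indicator_family_admissible: "indicator_family s \<in> admissible"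
  by (simp add: indicator_family_def admissible_def)

lemma rearrange_eq_indicator_family:
  "rearrange E w r \<alpha> \<sigma> \<phi> = indicator_family (\<sigma> (ground_states E w r \<alpha> \<phi>))"
  by (simp add: rearrange_def indicator_family_def)

lemma finite_range_rearrange:
  "finite (range (rearrange E w r \<alpha> (\<sigma> :: real ^ 'v::finite ^ 'k::finite \<Rightarrow> 'v \<Rightarrow> 'k)))"
  by (rule finite_subset[of _ "range indicator_family"]) (auto simp: rearrange_eq_indicator_family)

text \<open>Separated from the rule \<open>\<sigma>\<close> so that all labellings allowed by one
  family can be compared; there are finitely many.\<close>

definition arg_max_labelling :: "real ^ 'v::finite ^ 'k::finite \<Rightarrow> ('v \<Rightarrow> 'k) \<Rightarrow> bool" where
  "arg_max_labelling \<psi> s \<longleftrightarrow> (\<forall>v j. \<psi> $ j $ v \<le> \<psi> $ s v $ v)"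

lemma arg_max_rule_iff: "arg_max_rule \<sigma> \<longleftrightarrow> (\<forall>\<psi>. arg_max_labelling \<psi> (\<sigma> \<psi>))"
  by (auto simp: arg_max_rule_def arg_max_labelling_def is_arg_max_linorder)

lemma ex_arg_max_labelling: "\<exists>s. arg_max_labelling \<psi> s"
proof -
  have "\<exists>i. \<forall>j. \<psi> $ j $ v \<le> \<psi> $ i $ v" for v
  proof -
    have "Max (range (\<lambda>j. \<psi> $ j $ v)) \<in> range (\<lambda>j. \<psi> $ j $ v)"
      by (rule Max_in) auto
    then obtain i where "Max (range (\<lambda>j. \<psi> $ j $ v)) = \<psi> $ i $ v"
      by (rule rangeE)
    moreover have "\<psi> $ j $ v \<le> Max (range (\<lambda>j. \<psi> $ j $ v))" for j
      by (rule Max_ge) auto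
    ultimately show ?thesis by auto
  qed
  then show ?thesis unfolding arg_max_labelling_def by metis
qed

section \<open>Existence, uniqueness and continuity of ground states\<close>

text \<open>Positivity of \<open>deg_pow\<close> follows from connectedness when there are at least
  two vertices. Assuming it directly also covers a single vertex whose weight is positive.\<close>

locale graph_energy =
  fixes E :: "('v::finite \<times> 'v) set" and w :: "'v \<Rightarrow> 'v \<Rightarrow> real" and r \<alpha> :: real
  assumes graph: "weighted_graph E w" and conn: "connected_weights w"
    and \<alpha>_pos: "0 < \<alpha>" and deg_pow_pos: "\<And>v. 0 < deg_pow w r v"
begin

lemma deg_pow_nonneg: "0 \<le> deg_pow w r v"
  using deg_pow_pos[of v] by simp

lemma compact_norm_sq_eq_1: "compact {\<psi>. norm_sq w r \<psi> = 1}"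
proof -
  have "norm \<psi> \<le> sqrt (\<Sum>v\<in>UNIV. 1 / deg_pow w r v)" if "norm_sq w r \<psi> = 1" for \<psi>
  proof -
    have "deg_pow w r v * (\<psi> $ v)\<^sup>2 \<le> norm_sq w r \<psi>" for v
      unfolding norm_sq_def
      by (rule member_le_sum) (simp_all add: deg_pow_nonneg)
    then have "(\<psi> $ v)\<^sup>2 \<le> 1 / deg_pow w r v" for v
      using that deg_pow_pos[of v] by (simp add: field_simps)
    then show ?thesis
      by (simp add: norm_vec_def L2_set_def sum_mono)
  qed
  then have "bounded {\<psi>. norm_sq w r \<psi> = 1}"
    by (auto simp: bounded_iff)
  moreover have "closed {\<psi>. norm_sq w r \<psi> = 1}"
    by (intro closed_Collect_eq continuous_on_norm_sq continuous_intros)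
  ultimately show ?thesis
    by (simp add: compact_eq_bounded_closed)
qed

lemma norm_sq_pos:
  assumes "\<psi> \<noteq> 0"
  shows "0 < norm_sq w r \<psi>"
proof -
  obtain v where "\<psi> $ v \<noteq> 0"
    using assms by (auto simp: vec_eq_iff)
  then show ?thesis
    unfolding norm_sq_def
    by (intro sum_pos2[of _ v]) (simp_all add: deg_pow_nonneg deg_pow_pos)
qed

lemma norm_sq_normalize:
  assumes "\<psi> \<noteq> 0"
  shows "norm_sq w r ((1 / sqrt (norm_sq w r \<psi>)) *\<^sub>R \<psi>) = 1"
  using norm_sq_pos[OF assms] by (simp add: norm_sq_scaleR power_divide)

lemma ex_minimizer:
  "\<exists>\<psi>. norm_sq w r \<psi> = 1 \<and> (\<forall>\<xi>. norm_sq w r \<xi> = 1 \<longrightarrow> quad E w r \<alpha> \<phi> \<psi> \<le> quad E w r \<alpha> \<phi> \<xi>)"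
proof -
  have "norm_sq w r ((1 / sqrt (norm_sq w r 1)) *\<^sub>R 1) = 1"
    by (rule norm_sq_normalize) (simp add: vec_eq_iff)
  then have "{\<psi>. norm_sq w r \<psi> = 1} \<noteq> {}" by blast
  then show ?thesis
    using continuous_attains_inf[OF compact_norm_sq_eq_1 _
        continuous_on_quad[OF continuous_on_const continuous_on_id]]
    by fastforce
qed

lemma lam_le:
  assumes "norm_sq w r \<psi> = 1"
  shows "lam E w r \<alpha> \<phi> \<le> quad E w r \<alpha> \<phi> \<psi>"
  unfolding lam_eq_Inf
proof (rule cINF_lower)
  show "bdd_below (quad E w r \<alpha> \<phi> ` {\<psi>. norm_sq w r \<psi> = 1})"
    using ex_minimizer[of \<phi>] by (auto simp: bdd_below_def)
qed (use assms in simp)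

lemma lam_eq_iff:
  assumes "norm_sq w r \<psi> = 1"
  shows "quad E w r \<alpha> \<phi> \<psi> = lam E w r \<alpha> \<phi> \<longleftrightarrow>
    (\<forall>\<xi>. norm_sq w r \<xi> = 1 \<longrightarrow> quad E w r \<alpha> \<phi> \<psi> \<le> quad E w r \<alpha> \<phi> \<xi>)"
proof
  assume "\<forall>\<xi>. norm_sq w r \<xi> = 1 \<longrightarrow> quad E w r \<alpha> \<phi> \<psi> \<le> quad E w r \<alpha> \<phi> \<xi>"
  then have "quad E w r \<alpha> \<phi> \<psi> \<le> lam E w r \<alpha> \<phi>"
    unfolding lam_eq_Inf using assms by (intro cINF_greatest) auto
  then show "quad E w r \<alpha> \<phi> \<psi> = lam E w r \<alpha> \<phi>"
    using lam_le[OF assms, of \<phi>] by simp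
qed (use lam_le in auto)

text \<open>By homogeneity the bound on normalized functions extends to all functions; it says that
  \<open>shifted_hamiltonian\<close> is positive semidefinite.\<close>

lemma lam_mult_norm_sq_le: "lam E w r \<alpha> \<phi> * norm_sq w r \<psi> \<le> quad E w r \<alpha> \<phi> \<psi>"
proof (cases "\<psi> = 0")
  case True
  then show ?thesis
    using quad_scaleR[of E w r \<alpha> \<phi> 0 0] norm_sq_scaleR[of w r 0 0] by simp
next
  case False
  show ?thesis
    using lam_le[OF norm_sq_normalize[OF False], of \<phi>] norm_sq_pos[OF False]
    by (simp add: quad_scaleR power_divide field_simps)
qed

text \<open>This is D^r times the operator \<Delta>_r + \<alpha> (1 - \<phi>) minus its first
  eigenvalue, so its kernel is the first eigenspace.\<close>

definition shifted_hamiltonian :: "real ^ 'v \<Rightarrow> real ^ 'v ^ 'v" where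
  "shifted_hamiltonian \<phi> =
     hamiltonian w (\<chi> v. deg_pow w r v * (\<alpha> * (1 - \<phi> $ v) - lam E w r \<alpha> \<phi>))"

lemma inner_shifted_hamiltonian:
  "\<psi> \<bullet> (shifted_hamiltonian \<phi> *v \<psi>) = quad E w r \<alpha> \<phi> \<psi> - lam E w r \<alpha> \<phi> * norm_sq w r \<psi>"
proof -
  have "(\<Sum>v\<in>UNIV. deg_pow w r v * (\<alpha> * (1 - \<phi> $ v) - lam E w r \<alpha> \<phi>) * (\<psi> $ v)\<^sup>2)
      = \<alpha> * weighted_norm_sq w r (\<chi> v. 1 - \<phi> $ v) \<psi> - lam E w r \<alpha> \<phi> * norm_sq w r \<psi>"
    unfolding weighted_norm_sq_def norm_sq_def sum_distrib_left sum_subtractf[symmetric]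
    by (intro sum.cong) (auto simp: algebra_simps)
  then show ?thesis
    by (simp add: shifted_hamiltonian_def inner_hamiltonian[OF graph] quad_def)
qed

lemma shifted_hamiltonian_null_iff:
  assumes "norm_sq w r \<psi> = 1"
  shows "shifted_hamiltonian \<phi> *v \<psi> = 0 \<longleftrightarrow> quad E w r \<alpha> \<phi> \<psi> = lam E w r \<alpha> \<phi>"
proof
  assume "shifted_hamiltonian \<phi> *v \<psi> = 0"
  then show "quad E w r \<alpha> \<phi> \<psi> = lam E w r \<alpha> \<phi>"
    using inner_shifted_hamiltonian[of \<psi> \<phi>] assms by simp
next
  assume "quad E w r \<alpha> \<phi> \<psi> = lam E w r \<alpha> \<phi>"
  then show "shifted_hamiltonian \<phi> *v \<psi> = 0"
    using assms lam_mult_norm_sq_le transpose_hamiltonian[OF graph]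
    by (intro psd_matrix_null_vector) (auto simp: inner_shifted_hamiltonian, simp add: shifted_hamiltonian_def)
qed

lemma is_ground_state_iff_null:
  "is_ground_state E w r \<alpha> \<phi> \<psi> \<longleftrightarrow>
     (\<forall>v. 0 < \<psi> $ v) \<and> norm_sq w r \<psi> = 1 \<and> shifted_hamiltonian \<phi> *v \<psi> = 0"
proof -
  have "laplacian w r \<psi> $ v + \<alpha> * (1 - \<phi> $ v) * \<psi> $ v = lam E w r \<alpha> \<phi> * \<psi> $ v \<longleftrightarrow>
      (shifted_hamiltonian \<phi> *v \<psi>) $ v = 0" for v
    using deg_pow_pos[of v]
    by (simp add: shifted_hamiltonian_def hamiltonian_mult laplacian_def field_simps)
  then show ?thesis
    by (auto simp: is_ground_state_def vec_eq_iff)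
qed

text \<open>Strict positivity is weakened to a closed condition, as needed for continuity; the
  maximum principle recovers it.\<close>

lemma is_ground_state_iff_minimizer:
  "is_ground_state E w r \<alpha> \<phi> \<psi> \<longleftrightarrow>
     (\<forall>v. 0 \<le> \<psi> $ v) \<and> norm_sq w r \<psi> = 1 \<and> quad E w r \<alpha> \<phi> \<psi> = lam E w r \<alpha> \<phi>"
proof -
  have "0 < \<psi> $ v"
    if "\<forall>v. 0 \<le> \<psi> $ v" "norm_sq w r \<psi> = 1" "shifted_hamiltonian \<phi> *v \<psi> = 0" for v
  proof (rule ccontr)
    assume "\<not> 0 < \<psi> $ v"
    then have "\<psi> $ v = 0" using that(1) by (simp add: order_antisym not_less)
    then have "\<psi> = 0"
      using that nonneg_null_vector_hamiltonian[OF graph conn]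
      unfolding shifted_hamiltonian_def by blast
    then show False using that(2) norm_sq_scaleR[of w r 0 0] by simp
  qed
  then show ?thesis
    unfolding is_ground_state_iff_null
    using shifted_hamiltonian_null_iff less_imp_le by blast
qed

lemma quad_abs_le: "quad E w r \<alpha> \<phi> (\<chi> v. \<bar>\<psi> $ v\<bar>) \<le> quad E w r \<alpha> \<phi> \<psi>"
proof -
  have "(\<bar>a\<bar> - \<bar>b\<bar>)\<^sup>2 \<le> (a - b)\<^sup>2" for a b :: real
    by (rule abs_le_square_iff[THEN iffD1]) linarith
  then have "grad_sq E w (\<chi> v. \<bar>\<psi> $ v\<bar>) \<le> grad_sq E w \<psi>"
    using graph by (auto simp: grad_sq_def weighted_graph_def intro!: sum_mono mult_left_mono)
  then show ?thesis
    by (simp add: quad_def weighted_norm_sq_def)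
qed

text \<open>The absolute value of a minimizer is again a minimizer, hence a ground state. Two ground
  states are proportional, and normalization makes the positive factor 1.\<close>

lemma ex1_ground_state: "\<exists>!\<psi>. is_ground_state E w r \<alpha> \<phi> \<psi>"
proof -
  obtain \<xi> where \<xi>: "norm_sq w r \<xi> = 1" "quad E w r \<alpha> \<phi> \<xi> = lam E w r \<alpha> \<phi>"
    using ex_minimizer[of \<phi>] by (auto simp: lam_eq_iff)
  define \<psi> :: "real ^ 'v" where "\<psi> = (\<chi> v. \<bar>\<xi> $ v\<bar>)"
  have norm: "norm_sq w r \<psi> = 1"
    using \<xi> by (simp add: \<psi>_def norm_sq_def)
  then have "quad E w r \<alpha> \<phi> \<psi> = lam E w r \<alpha> \<phi>"
    using \<xi> quad_abs_le[of \<phi> \<xi>] lam_le[of \<psi> \<phi>] by (simp add: \<psi>_def)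
  then have "is_ground_state E w r \<alpha> \<phi> \<psi>"
    using norm by (simp add: is_ground_state_iff_minimizer \<psi>_def)
  moreover have "x = y" if gs: "is_ground_state E w r \<alpha> \<phi> x" "is_ground_state E w r \<alpha> \<phi> y" for x y
  proof -
    obtain t where t: "0 < t" "x = t *\<^sub>R y"
      by (rule null_vector_hamiltonian_unique[OF graph conn, where x = x and y = y])
        (use gs in \<open>auto simp: is_ground_state_iff_null shifted_hamiltonian_def\<close>)
    then have "t\<^sup>2 = 1"
      using gs by (simp add: is_ground_state_iff_null norm_sq_scaleR)
    then show ?thesis using t by (simp add: power2_eq_1_iff)
  qed
  ultimately show ?thesis by blast
qed

lemma ground_state: "is_ground_state E w r \<alpha> \<phi> (ground_state E w r \<alpha> \<phi>)"
  unfolding ground_state_def by (rule theI'[OF ex1_ground_state])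

lemma ground_state_unique: "is_ground_state E w r \<alpha> \<phi> \<psi> \<Longrightarrow> ground_state E w r \<alpha> \<phi> = \<psi>"
  using ground_state ex1_ground_state by blast

text \<open>A map into a compact set is continuous once its graph is closed.\<close>

lemma continuous_on_ground_state: "continuous_on UNIV (ground_state E w r \<alpha>)"
proof -
  let ?S = "{\<psi>. norm_sq w r \<psi> = 1}"
  \<comment> \<open>Minimality is tested against each fixed competitor instead of the value
    \<open>lam\<close>, so that closedness follows from continuity of \<open>quad\<close>
    alone.\<close>
  let ?G = "{p. (\<forall>v. 0 \<le> snd p $ v) \<and> norm_sq w r (snd p) = 1 \<and>
    (\<forall>\<xi>. norm_sq w r \<xi> = 1 \<longrightarrow> quad E w r \<alpha> (fst p) (snd p) \<le> quad E w r \<alpha> (fst p) \<xi>)}"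
  have graph_iff: "ground_state E w r \<alpha> \<phi> = \<psi> \<longleftrightarrow> (\<phi>, \<psi>) \<in> ?G" for \<phi> \<psi>
  proof -
    have "ground_state E w r \<alpha> \<phi> = \<psi> \<longleftrightarrow> is_ground_state E w r \<alpha> \<phi> \<psi>"
      using ground_state ground_state_unique by blast
    then show ?thesis
      by (auto simp: is_ground_state_iff_minimizer lam_eq_iff)
  qed
  have "closed ?G"
    by (intro closed_Collect_conj closed_Collect_all closed_Collect_imp closed_Collect_le
        closed_Collect_eq continuous_on_quad continuous_on_norm_sq continuous_intros) auto
  moreover have "(\<lambda>\<phi>. (\<phi>, ground_state E w r \<alpha> \<phi>)) ` UNIV = ?G"
  proof -
    have "range (\<lambda>\<phi>. (\<phi>, ground_state E w r \<alpha> \<phi>)) = {p. ground_state E w r \<alpha> (fst p) = snd p}"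
      by force
    also have "\<dots> = ?G"
      unfolding graph_iff by simp
    finally show ?thesis .
  qed
  ultimately have "closedin (top_of_set (UNIV \<times> ?S)) ((\<lambda>\<phi>. (\<phi>, ground_state E w r \<alpha> \<phi>)) ` UNIV)"
    by (auto intro: closed_subset)
  then show ?thesis
    using ground_state
    by (subst continuous_closed_graph_eq[OF compact_norm_sq_eq_1])
      (auto simp: is_ground_state_def)
qed

section \<open>Descent of the energy and termination\<close>

lemma quad_alt:
  "quad E w r \<alpha> \<phi> \<psi> = grad_sq E w \<psi> + \<alpha> * norm_sq w r \<psi> - \<alpha> * weighted_norm_sq w r \<phi> \<psi>"
  unfolding quad_def weighted_norm_sq_def norm_sq_def
  by (simp add: sum_subtractf algebra_simps)

text \<open>By \<open>quad_alt\<close>, the family enters only through a weighted sum to be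
  maximized. At each vertex that sum is a convex combination of the squares of the values of the
  \<open>\<psi> $ i\<close>, largest when all mass sits on a maximal one; positivity makes the arg
  max of the values one of the squares.\<close>

lemma sum_quad_indicator_family_le:
  assumes s: "arg_max_labelling \<psi> s" and pos: "\<And>i v. 0 < \<psi> $ i $ v" and \<phi>: "\<phi> \<in> admissible"
  shows "(\<Sum>i\<in>UNIV. quad E w r \<alpha> (indicator_family s $ i) (\<psi> $ i))
    \<le> (\<Sum>i\<in>UNIV. quad E w r \<alpha> (\<phi> $ i) (\<psi> $ i))"
proof -
  have "(\<Sum>i\<in>UNIV. \<phi> $ i $ v * (\<psi> $ i $ v)\<^sup>2)
      \<le> (\<Sum>i\<in>UNIV. indicator_family s $ i $ v * (\<psi> $ i $ v)\<^sup>2)" for v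
  proof -
    have "(\<Sum>i\<in>UNIV. \<phi> $ i $ v * (\<psi> $ i $ v)\<^sup>2) \<le> (\<Sum>i\<in>UNIV. \<phi> $ i $ v * (\<psi> $ s v $ v)\<^sup>2)"
      using s \<phi> pos by (intro sum_mono mult_left_mono power_mono)
        (auto simp: arg_max_labelling_def admissible_def less_imp_le)
    also have "\<dots> = (\<psi> $ s v $ v)\<^sup>2"
      using \<phi> by (simp add: sum_distrib_right[symmetric] admissible_def)
    also have "\<dots> = (\<Sum>i\<in>UNIV. indicator_family s $ i $ v * (\<psi> $ i $ v)\<^sup>2)"
      by (simp add: indicator_family_def if_distrib[of "\<lambda>x. x * _"] cong: if_cong)
    finally show ?thesis .
  qed
  then have "(\<Sum>v\<in>UNIV. deg_pow w r v * (\<Sum>i\<in>UNIV. \<phi> $ i $ v * (\<psi> $ i $ v)\<^sup>2))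
      \<le> (\<Sum>v\<in>UNIV. deg_pow w r v * (\<Sum>i\<in>UNIV. indicator_family s $ i $ v * (\<psi> $ i $ v)\<^sup>2))"
    by (rule sum_mono[OF mult_left_mono]) (rule deg_pow_nonneg)
  moreover have "(\<Sum>v\<in>UNIV. deg_pow w r v * (\<Sum>i\<in>UNIV. \<theta> $ i $ v * (\<psi> $ i $ v)\<^sup>2))
      = (\<Sum>i\<in>UNIV. weighted_norm_sq w r (\<theta> $ i) (\<psi> $ i))" for \<theta>
    unfolding weighted_norm_sq_def sum_distrib_left mult.assoc by (rule sum.swap)
  ultimately have "(\<Sum>i\<in>UNIV. weighted_norm_sq w r (\<phi> $ i) (\<psi> $ i))
      \<le> (\<Sum>i\<in>UNIV. weighted_norm_sq w r (indicator_family s $ i) (\<psi> $ i))"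
    by simp
  then show ?thesis
    using \<alpha>_pos
    by (auto simp: quad_alt sum_subtractf sum_distrib_left[symmetric] intro: mult_left_mono)
qed

lemma is_ground_state_ground_states:
  "is_ground_state E w r \<alpha> (\<phi> $ i) (ground_states E w r \<alpha> \<phi> $ i)"
  by (simp add: ground_states_def ground_state)

lemma ground_states_pos: "0 < ground_states E w r \<alpha> \<phi> $ i $ v"
  using is_ground_state_ground_states by (auto simp: is_ground_state_def)

lemma norm_sq_ground_states: "norm_sq w r (ground_states E w r \<alpha> \<phi> $ i) = 1"
  using is_ground_state_ground_states by (auto simp: is_ground_state_def)

lemma energy_eq_sum_quad:
  "energy E w r \<alpha> \<phi> = (\<Sum>i\<in>UNIV. quad E w r \<alpha> (\<phi> $ i) (ground_states E w r \<alpha> \<phi> $ i))"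
  unfolding energy_def
  by (intro sum.cong refl)
    (use is_ground_state_ground_states[of \<phi>] in \<open>simp add: is_ground_state_iff_minimizer\<close>)

lemma energy_indicator_family_le:
  assumes s: "arg_max_labelling (ground_states E w r \<alpha> \<phi>) s" and \<phi>: "\<phi> \<in> admissible"
  shows "energy E w r \<alpha> (indicator_family s) \<le> energy E w r \<alpha> \<phi>"
proof -
  have "energy E w r \<alpha> (indicator_family s)
      \<le> (\<Sum>i\<in>UNIV. quad E w r \<alpha> (indicator_family s $ i) (ground_states E w r \<alpha> \<phi> $ i))"
    unfolding energy_def by (intro sum_mono lam_le norm_sq_ground_states)
  also have "\<dots> \<le> energy E w r \<alpha> \<phi>"
    unfolding energy_eq_sum_quad
    by (rule sum_quad_indicator_family_le[OF s ground_states_pos \<phi>])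
  finally show ?thesis .
qed

text \<open>Both inequalities in the descent estimate become equalities. Each old ground state then
  attains the new eigenvalue, and uniqueness identifies it with the new ground state.\<close>

lemma ground_states_eq_if_energy_eq:
  assumes s: "arg_max_labelling (ground_states E w r \<alpha> \<phi>) s" and \<phi>: "\<phi> \<in> admissible"
    and eq: "energy E w r \<alpha> (indicator_family s) = energy E w r \<alpha> \<phi>"
  shows "ground_states E w r \<alpha> (indicator_family s) = ground_states E w r \<alpha> \<phi>"
proof -
  let ?\<psi> = "ground_states E w r \<alpha> \<phi>"
  have "(\<Sum>i\<in>UNIV. quad E w r \<alpha> (indicator_family s $ i) (?\<psi> $ i))
      \<le> (\<Sum>i\<in>UNIV. lam E w r \<alpha> (indicator_family s $ i))"
    using sum_quad_indicator_family_le[OF s ground_states_pos \<phi>] eq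
    by (simp add: energy_eq_sum_quad[of \<phi>] energy_def[of _ _ _ _ "indicator_family s"])
  then have "(\<Sum>i\<in>UNIV. lam E w r \<alpha> (indicator_family s $ i)) =
      (\<Sum>i\<in>UNIV. quad E w r \<alpha> (indicator_family s $ i) (?\<psi> $ i))"
    by (rule antisym[rotated]) (intro sum_mono lam_le norm_sq_ground_states)
  then have "lam E w r \<alpha> (indicator_family s $ i) = quad E w r \<alpha> (indicator_family s $ i) (?\<psi> $ i)" for i
    by (rule sum_mono_inv) (auto intro!: lam_le norm_sq_ground_states)
  then have "is_ground_state E w r \<alpha> (indicator_family s $ i) (?\<psi> $ i)" for i
    by (simp add: is_ground_state_iff_minimizer norm_sq_ground_states
        less_imp_le[OF ground_states_pos])
  then show ?thesis
    by (metis ground_state_unique ground_states_def vec_lambda_beta vec_lambda_unique)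
qed

lemma rearrange_terminates:
  fixes \<phi> :: "real ^ 'v ^ 'k::finite"
  assumes \<sigma>: "arg_max_rule \<sigma>" and \<phi>: "\<phi> \<in> admissible"
  shows "\<exists>\<phi>'\<in>admissible. terminates_at (rearrange E w r \<alpha> \<sigma>) \<phi> \<phi>'"
proof (rule terminates_at_decreasing[OF finite_range_rearrange _ _ _ \<phi>, where f = "energy E w r \<alpha>"])
  have lab: "arg_max_labelling \<psi> (\<sigma> \<psi>)" for \<psi>
    using \<sigma> by (simp add: arg_max_rule_iff)
  fix x :: "real ^ 'v ^ 'k" assume x: "x \<in> admissible"
  show "rearrange E w r \<alpha> \<sigma> x \<in> admissible"
    by (simp add: rearrange_eq_indicator_family indicator_family_admissible)
  show "energy E w r \<alpha> (rearrange E w r \<alpha> \<sigma> x) \<le> energy E w r \<alpha> x"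
    unfolding rearrange_eq_indicator_family by (rule energy_indicator_family_le[OF lab x])
  assume "energy E w r \<alpha> (rearrange E w r \<alpha> \<sigma> x) = energy E w r \<alpha> x"
  \<comment> \<open>The rule is a function of the ground states, so equal ground states give equal
    labels even at ties.\<close>
  then show "rearrange E w r \<alpha> \<sigma> (rearrange E w r \<alpha> \<sigma> x) = rearrange E w r \<alpha> \<sigma> x"
    using ground_states_eq_if_energy_eq[OF lab x] by (simp add: rearrange_eq_indicator_family)
qed

section \<open>Local minimality of tie-free fixed points\<close>

lemma tendsto_ground_states:
  "((\<lambda>\<theta>. ground_states E w r \<alpha> \<theta> $ i $ v) \<longlongrightarrow> ground_states E w r \<alpha> \<phi> $ i $ v) (at \<phi> within S)"
proof -
  have "continuous_on UNIV (\<lambda>\<theta>. ground_states E w r \<alpha> \<theta> $ i $ v)"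
    unfolding ground_states_def vec_lambda_beta
    by (intro continuous_intros continuous_on_compose2[OF continuous_on_ground_state]) auto
  then show ?thesis
    by (auto simp: continuous_on_def intro: tendsto_within_subset)
qed

lemma local_min_if_tie_free:
  assumes \<sigma>: "arg_max_rule \<sigma>" and \<phi>: "\<phi> \<in> admissible"
    and fixpoint: "rearrange E w r \<alpha> \<sigma> \<phi> = \<phi>"
    and tie_free: "tie_free (ground_states E w r \<alpha> \<phi>)"
  shows "is_local_min_on admissible (energy E w r \<alpha>) \<phi>"
proof -
  let ?g = "ground_states E w r \<alpha>"
  have lab: "arg_max_labelling \<psi> (\<sigma> \<psi>)" for \<psi>
    using \<sigma> by (simp add: arg_max_rule_iff)
  have strict: "?g \<phi> $ j $ v < ?g \<phi> $ \<sigma> (?g \<phi>) v $ v" if "j \<noteq> \<sigma> (?g \<phi>) v" for j v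
  proof (rule ccontr)
    assume "\<not> ?thesis"
    then have "\<forall>i. ?g \<phi> $ i $ v \<le> ?g \<phi> $ j $ v"
      using lab[of "?g \<phi>"] unfolding arg_max_labelling_def by (meson not_less order_trans)
    then show False
      using that tie_free lab[of "?g \<phi>"]
      unfolding tie_free_def is_arg_max_linorder arg_max_labelling_def by blast
  qed
  have "\<forall>\<^sub>F \<theta> in at \<phi> within admissible.
      j \<noteq> \<sigma> (?g \<phi>) v \<longrightarrow> ?g \<theta> $ j $ v < ?g \<theta> $ \<sigma> (?g \<phi>) v $ v" for v j
  proof (cases "j = \<sigma> (?g \<phi>) v")
    case False
    then have "0 < ?g \<phi> $ \<sigma> (?g \<phi>) v $ v - ?g \<phi> $ j $ v"
      using strict by simp
    then have "\<forall>\<^sub>F \<theta> in at \<phi> within admissible. 0 < ?g \<theta> $ \<sigma> (?g \<phi>) v $ v - ?g \<theta> $ j $ v"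
      by (rule order_tendstoD(1)[OF tendsto_diff[OF tendsto_ground_states tendsto_ground_states]])
    then show ?thesis
      by (rule eventually_mono) simp
  qed simp
  then have "\<forall>\<^sub>F \<theta> in at \<phi> within admissible.
      \<forall>v j. j \<noteq> \<sigma> (?g \<phi>) v \<longrightarrow> ?g \<theta> $ j $ v < ?g \<theta> $ \<sigma> (?g \<phi>) v $ v"
    by (intro eventually_all_finite)
  moreover have "\<forall>\<^sub>F \<theta> in at \<phi> within admissible. \<theta> \<in> admissible"
    by (simp add: eventually_at_filter)
  ultimately have "\<forall>\<^sub>F \<theta> in at \<phi> within admissible. energy E w r \<alpha> \<phi> \<le> energy E w r \<alpha> \<theta>"
  proof eventually_elim
    case (elim \<theta>)
    \<comment> \<open>The strict inequalities leave the rule no choice at \<open>\<theta>\<close>,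
      however irregular \<open>\<sigma>\<close> may be.\<close>
    have "\<sigma> (?g \<theta>) v = \<sigma> (?g \<phi>) v" for v
      using elim(1) lab[of "?g \<theta>"] unfolding arg_max_labelling_def by (meson not_less)
    then have "indicator_family (\<sigma> (?g \<theta>)) = \<phi>"
      using fixpoint unfolding rearrange_eq_indicator_family by presburger
    then show ?case
      using energy_indicator_family_le[OF lab elim(2)] by simp
  qed
  then show ?thesis
    using \<phi> by (simp add: is_local_min_on_def)
qed

section \<open>Least-energy tie-breaking excludes ties\<close>

text \<open>Subtracting the two eigenvalue equations cancels the Laplacian, and dividing by the
  positive \<open>\<psi> $ v\<close> leaves a difference of eigenvalues that is independent of the
  vertex.\<close>

lemma potential_diff_const:
  assumes "is_ground_state E w r \<alpha> \<phi> \<psi>" "is_ground_state E w r \<alpha> \<theta> \<psi>"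
  shows "\<theta> $ u - \<phi> $ u = \<theta> $ v - \<phi> $ v"
proof -
  have "\<alpha> * (\<theta> $ v - \<phi> $ v) = lam E w r \<alpha> \<phi> - lam E w r \<alpha> \<theta>" for v
  proof -
    have "laplacian w r \<psi> $ v + \<alpha> * (1 - \<phi> $ v) * \<psi> $ v = lam E w r \<alpha> \<phi> * \<psi> $ v"
      "laplacian w r \<psi> $ v + \<alpha> * (1 - \<theta> $ v) * \<psi> $ v = lam E w r \<alpha> \<theta> * \<psi> $ v"
      and pos: "0 < \<psi> $ v"
      using assms by (auto simp: is_ground_state_def)
    then have "\<alpha> * (\<theta> $ v - \<phi> $ v) * \<psi> $ v = (lam E w r \<alpha> \<phi> - lam E w r \<alpha> \<theta>) * \<psi> $ v"
      by (simp add: algebra_simps)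
    then show ?thesis using pos by simp
  qed
  then show ?thesis
    using \<alpha>_pos by (metis mult_cancel_left less_irrefl)
qed

text \<open>A tie at \<open>v\<close> would let \<open>v\<close> change its label without changing the energy, hence without
  changing the ground states. But these determine each potential up to an additive constant, and
  the move changes two of the potentials at \<open>v\<close> only.\<close>

lemma tie_free_if_minimal_labelling:
  fixes s :: "'v \<Rightarrow> 'k::finite"
  defines "\<psi> \<equiv> ground_states E w r \<alpha> (indicator_family s)"
  assumes two: "\<And>v :: 'v. \<exists>u. u \<noteq> v"
    and s: "arg_max_labelling \<psi> s"
    and min: "\<And>t. arg_max_labelling \<psi> t \<Longrightarrow>
      energy E w r \<alpha> (indicator_family s) \<le> energy E w r \<alpha> (indicator_family t)"
  shows "tie_free \<psi>"
  unfolding tie_free_def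
proof
  fix v
  have "j = s v" if j: "is_arg_max (\<lambda>j. \<psi> $ j $ v) (\<lambda>j. True) j" for j
  proof (rule ccontr)
    assume neq: "j \<noteq> s v"
    define t where "t = s(v := j)"
    have t: "arg_max_labelling \<psi> t"
      using s j by (auto simp: t_def arg_max_labelling_def is_arg_max_linorder)
    \<comment> \<open>One inequality is minimality of \<open>s\<close>, the other is descent:
      \<open>t\<close> is also an arg max labelling of the ground states of
      \<open>s\<close>.\<close>
    have "energy E w r \<alpha> (indicator_family t) = energy E w r \<alpha> (indicator_family s)"
      using min[OF t] energy_indicator_family_le[OF t[unfolded \<psi>_def] indicator_family_admissible]
      by simp
    then have "ground_states E w r \<alpha> (indicator_family t) = \<psi>"
      using ground_states_eq_if_energy_eq[OF t[unfolded \<psi>_def] indicator_family_admissible]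
      by (simp add: \<psi>_def)
    then have "is_ground_state E w r \<alpha> (indicator_family t $ j) (\<psi> $ j)"
      "is_ground_state E w r \<alpha> (indicator_family s $ j) (\<psi> $ j)"
      using is_ground_state_ground_states unfolding \<psi>_def by metis+
    moreover obtain u where "u \<noteq> v" using two by blast
    ultimately show False
      using potential_diff_const[of "indicator_family s $ j" "\<psi> $ j" "indicator_family t $ j" u v] neq
      by (simp add: indicator_family_def t_def)
  qed
  moreover have "is_arg_max (\<lambda>j. \<psi> $ j $ v) (\<lambda>j. True) (s v)"
    using s by (simp add: arg_max_labelling_def is_arg_max_linorder)
  ultimately show "\<exists>!i. is_arg_max (\<lambda>j. \<psi> $ j $ v) (\<lambda>j. True) i"
    by blast
qed

end

section \<open>Positive vertex weights and the single-vertex case\<close>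

text \<open>A path from \<open>v\<close> to another vertex starts with an edge of positive weight at
  \<open>v\<close>.\<close>

lemma deg_pow_pos_if_connected:
  assumes "weighted_graph E w" "connected_weights w" "u \<noteq> v"
  shows "0 < deg_pow w r v"
proof -
  have "(v, u) \<in> {(a, b). 0 < w a b}\<^sup>*"
    using assms by (simp add: connected_weights_def)
  then obtain b where "0 < w v b"
    using assms(3) by (auto elim: converse_rtranclE)
  moreover have "\<And>j. 0 \<le> w v j"
    using assms by (simp add: weighted_graph_def)
  ultimately have "0 < deg w v"
    unfolding deg_def by (intro sum_pos2[of _ b]) auto
  then show ?thesis by (simp add: deg_pow_def)
qed

text \<open>Without differences between vertices the gradient vanishes and \<open>quad\<close> is
  constant on normalized functions. Since the family sums to 1, the energy is constant on
  \<open>admissible\<close>.\<close>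

lemma singleton_local_min:
  fixes \<phi> :: "real ^ 'v::finite ^ 'k::finite"
  assumes single: "\<And>v :: 'v. v = u" and \<phi>: "\<phi> \<in> admissible"
  shows "is_local_min_on admissible (energy E w r \<alpha>) \<phi>"
proof -
  have UNIV: "UNIV = {u}" using single by auto
  have quad: "quad E w r \<alpha> \<theta> \<psi> = \<alpha> * (1 - \<theta> $ u) * norm_sq w r \<psi>" for \<theta> \<psi>
  proof -
    have "grad_sq E w \<psi> = 0"
      unfolding grad_sq_def using single
      by (metis (mono_tags, lifting) case_prod_unfold cancel_comm_monoid_add_class.diff_cancel
          div_0 mult_zero_right power_zero_numeral sum.neutral)
    then show ?thesis
      by (simp add: quad_def weighted_norm_sq_def norm_sq_def UNIV)
  qed
  \<comment> \<open>If the weight vanishes there is no normalized function; \<open>lam\<close> is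
    then the default \<open>Inf {}\<close> for every potential, and the energy is still
    constant.\<close>
  have lam: "lam E w r \<alpha> \<theta> =
      (if {\<psi>. norm_sq w r \<psi> = 1} = {} then Inf {} else \<alpha> * (1 - \<theta> $ u))" for \<theta>
  proof (cases "{\<psi>. norm_sq w r \<psi> = 1} = {}")
    case False
    have "quad E w r \<alpha> \<theta> ` {\<psi>. norm_sq w r \<psi> = 1} = (\<lambda>_. \<alpha> * (1 - \<theta> $ u)) ` {\<psi>. norm_sq w r \<psi> = 1}"
      by (rule image_cong) (simp_all add: quad)
    then show ?thesis
      using False cINF_const[OF False, of "\<alpha> * (1 - \<theta> $ u)"]
      by (simp only: lam_eq_Inf if_False)
  qed (simp add: lam_eq_Inf)
  have "(\<Sum>i\<in>UNIV. \<alpha> * (1 - \<theta> $ i $ u)) = \<alpha> * (real CARD('k) - 1)"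
    if "\<theta> \<in> admissible" for \<theta> :: "real ^ 'v ^ 'k"
  proof -
    have "(\<Sum>i\<in>UNIV. \<theta> $ i $ u) = 1"
      using that by (simp add: admissible_def)
    then show ?thesis
      unfolding sum_distrib_left[symmetric] sum_subtractf by simp
  qed
  then have "energy E w r \<alpha> \<phi> \<le> energy E w r \<alpha> \<theta>"
    if "\<theta> \<in> admissible" for \<theta> :: "real ^ 'v ^ 'k"
    unfolding energy_def lam using that \<phi>
    by (cases "{\<psi>. norm_sq w r \<psi> = 1} = {}") (simp_all only: simp_thms if_True if_False order_refl)
  then show ?thesis
    using \<phi> unfolding is_local_min_on_def eventually_at_filter
    by (intro conjI always_eventually) simp_all
qed

text \<open>The case of a single isolated vertex and \<open>r > 0\<close>: the weight \<open>d\<^sup>r\<close> vanishes, so there is no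
  normalized function at all, and \<open>ground_state\<close> is an unspecified value that is the same for
  all potentials.\<close>

lemma singleton_degenerate_terminates:
  fixes \<phi> :: "real ^ 'v::finite ^ 'k::finite"
  assumes single: "\<And>v :: 'v. v = u" and "\<not> 0 < deg_pow w r u"
  shows "\<exists>\<phi>'\<in>admissible. terminates_at (rearrange E w r \<alpha> \<sigma>) \<phi> \<phi>'"
proof -
  have UNIV: "UNIV = {u}" using single by auto
  have "norm_sq w r \<psi> \<le> 0" for \<psi>
    using assms by (simp add: norm_sq_def UNIV mult_nonpos_nonneg)
  then have "\<not> is_ground_state E w r \<alpha> \<theta> \<psi>" for \<theta> \<psi>
    by (metis is_ground_state_def not_one_le_zero)
  then have "rearrange E w r \<alpha> \<sigma> \<theta> = rearrange E w r \<alpha> \<sigma> \<phi>" for \<theta>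
    by (simp add: rearrange_def ground_states_def ground_state_def)
  then have "terminates_at (rearrange E w r \<alpha> \<sigma>) \<phi> (rearrange E w r \<alpha> \<sigma> \<phi>)"
    unfolding terminates_at_def by (metis funpow_0 funpow.simps(2) comp_apply)
  then show ?thesis
    unfolding rearrange_eq_indicator_family using indicator_family_admissible by blast
qed

text \<open>Local minimality rests on strict maxima, which an arbitrary tie-break need not produce;
  hence one half conditional on \<open>tie_free\<close> for every rule, and one unconditional half
  for a suitable rule.\<close>

theorem theorem3p5:
  fixes E :: "('v::finite \<times> 'v) set"
    and w :: "'v \<Rightarrow> 'v \<Rightarrow> real"
    and r \<alpha> :: real
  assumes "weighted_graph E w" and "connected_weights w"
    and "0 \<le> r" and "r \<le> 1" and "0 < \<alpha>"
  shows
    "(\<forall>\<sigma> :: real ^ 'v ^ 'k::finite \<Rightarrow> 'v \<Rightarrow> 'k. arg_max_rule \<sigma> \<longrightarrow>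
        (\<forall>\<phi> \<in> admissible. \<exists>\<phi>'. terminates_at (rearrange E w r \<alpha> \<sigma>) \<phi> \<phi>' \<and>
           (tie_free (ground_states E w r \<alpha> \<phi>') \<longrightarrow>
              is_local_min_on admissible (energy E w r \<alpha>) \<phi>'))) \<and>
     (\<exists>\<sigma> :: real ^ 'v ^ 'k::finite \<Rightarrow> 'v \<Rightarrow> 'k. arg_max_rule \<sigma> \<and>
        (\<forall>\<phi> \<in> admissible. \<exists>\<phi>'. terminates_at (rearrange E w r \<alpha> \<sigma>) \<phi> \<phi>' \<and>
           is_local_min_on admissible (energy E w r \<alpha>) \<phi>'))"
proof -
  have terminates: "\<exists>\<phi>'\<in>admissible. terminates_at (rearrange E w r \<alpha> \<sigma>) \<phi> \<phi>'"
    if \<sigma>: "arg_max_rule \<sigma>" and \<phi>: "\<phi> \<in> admissible"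
    for \<sigma> :: "real ^ 'v ^ 'k \<Rightarrow> 'v \<Rightarrow> 'k" and \<phi>
  proof (cases "\<forall>v. 0 < deg_pow w r v")
    case True
    then interpret graph_energy E w r \<alpha>
      using assms by unfold_locales auto
    show ?thesis using \<sigma> \<phi> by (rule rearrange_terminates)
  next
    case False
    then obtain u where u: "\<not> 0 < deg_pow w r u" by blast
    then have "v = u" for v
      using deg_pow_pos_if_connected[OF assms(1,2)] by blast
    then show ?thesis
      using u by (rule singleton_degenerate_terminates)
  qed
  \<comment> \<open>The rule \<open>\<sigma>\<^sub>0\<close> for the second half picks, among the
    finitely many arg max labellings of \<open>\<psi>\<close>, one of least energy.\<close>
  have "\<exists>s. arg_max_labelling \<psi> s \<and> (\<forall>t. arg_max_labelling \<psi> t \<longrightarrow>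
      energy E w r \<alpha> (indicator_family s) \<le> energy E w r \<alpha> (indicator_family t))"
    for \<psi> :: "real ^ 'v ^ 'k"
    using ex_is_arg_min_if_finite[of "Collect (arg_max_labelling \<psi>)"
        "\<lambda>s. energy E w r \<alpha> (indicator_family s)"] ex_arg_max_labelling[of \<psi>]
    by (auto simp: is_arg_min_linorder)
  then obtain \<sigma>\<^sub>0 :: "real ^ 'v ^ 'k \<Rightarrow> 'v \<Rightarrow> 'k" where
    lab: "\<And>\<psi>. arg_max_labelling \<psi> (\<sigma>\<^sub>0 \<psi>)" and
    min: "\<And>\<psi> t. arg_max_labelling \<psi> t \<Longrightarrow>
      energy E w r \<alpha> (indicator_family (\<sigma>\<^sub>0 \<psi>)) \<le> energy E w r \<alpha> (indicator_family t)"
    by metis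
  have \<sigma>\<^sub>0: "arg_max_rule \<sigma>\<^sub>0"
    using lab by (simp add: arg_max_rule_iff)
  show ?thesis
  proof (cases "\<exists>u. \<forall>v :: 'v. v = u")
    case True
    then obtain u where "\<And>v :: 'v. v = u" by blast
    then have "is_local_min_on admissible (energy E w r \<alpha>) \<phi>" if "\<phi> \<in> admissible"
      for \<phi> :: "real ^ 'v ^ 'k"
      using that by (rule singleton_local_min)
    then show ?thesis
      using terminates \<sigma>\<^sub>0 by blast
  next
    case False
    then have two: "\<exists>u. u \<noteq> v" for v :: 'v by blast
    then interpret graph_energy E w r \<alpha>
      using assms deg_pow_pos_if_connected[OF assms(1,2)] by unfold_locales blast+
    have "is_local_min_on admissible (energy E w r \<alpha>) \<phi>"
      if \<phi>: "\<phi> \<in> admissible" and fixpoint: "rearrange E w r \<alpha> \<sigma>\<^sub>0 \<phi> = \<phi>" for \<phi>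
    proof -
      let ?s = "\<sigma>\<^sub>0 (ground_states E w r \<alpha> \<phi>)"
      \<comment> \<open>At a fixed point, \<open>\<phi>\<close> is the indicator family of the
        labelling chosen from its own ground states, so minimality of that choice is exactly what
        \<open>tie_free_if_minimal_labelling\<close> asks for.\<close>
      have s: "indicator_family ?s = \<phi>"
        using fixpoint by (simp add: rearrange_eq_indicator_family)
      have "tie_free (ground_states E w r \<alpha> \<phi>)"
        by (rule tie_free_if_minimal_labelling[OF two, of ?s, unfolded s, OF lab])
          (metis min s)
      then show ?thesis
        by (rule local_min_if_tie_free[OF \<sigma>\<^sub>0 \<phi> fixpoint])
    qed
    moreover have "rearrange E w r \<alpha> \<sigma> \<phi>' = \<phi>'"
      if "terminates_at (rearrange E w r \<alpha> \<sigma>) \<phi> \<phi>'"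
      for \<sigma> :: "real ^ 'v ^ 'k \<Rightarrow> 'v \<Rightarrow> 'k" and \<phi> \<phi>'
      using that by (simp add: terminates_at_def)
    ultimately show ?thesis
      using terminates \<sigma>\<^sub>0 by (meson local_min_if_tie_free)
  qed
qed

end
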